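(* Let $F:\mathbb H\to\mathbb D$ be univalent, and let $E\subset\mathbb R$ be a finite union of pairwise disjoint open intervals, possibly unbounded. Assume that (i) for almost every $x>0$ (with respect to Lebesgue measure), exactly one of $x,-x$ belongs to $E$; (ii) $F$ extends holomorphically across every interval comprising $E$; (iii) $|F|=1$ on $E$. Then $$\int_0^\infty |F'(iy)|\,dy\ \le\ \frac{\pi}{2}\int_E|F'(x)|\,dx .$$
   Context: $\mathbb H=\{z\in\mathbb C:\operatorname{Im}z>0\}$ is the open upper half-plane and $\mathbb D=\{z\in\mathbb C:|z|<1\}$ is the open unit disk. Univalent means holomorphic and injective (not necessarily onto $\mathbb D$). "$F$ extends holomorphically across an interval $I\subset\mathbb R$" means that there is a holomorphic function on an open neighborhood of $\mathbb H\cup I$ in $\mathbb C$ that agrees with $F$ on $\mathbb H$; the values $F(x)$ and $F'(x)$ for $x\in E$ are those of this extension. Integrals of nonnegative functions are understood in the extended sense, with values in $[0,\infty]$. *)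

theory Defs
  imports "HOL-Complex_Analysis.Complex_Analysis"
begin

definition upper_half_plane :: "complex set" where
  "upper_half_plane = {z. 0 < Im z}"

definition open_interval :: "real set \<Rightarrow> bool" where
  "open_interval I \<longleftrightarrow> open I \<and> is_interval I \<and> I \<noteq> {}"

definition is_extension_across :: "(complex \<Rightarrow> complex) \<Rightarrow> real set \<Rightarrow> (complex \<Rightarrow> complex) \<Rightarrow> bool" where
  "is_extension_across F I G \<longleftrightarrow>
     (\<exists>U. open U \<and> upper_half_plane \<union> complex_of_real ` I \<subseteq> U \<and> G holomorphic_on U \<and>
          (\<forall>z\<in>upper_half_plane. G z = F z))"

definition extends_across :: "(complex \<Rightarrow> complex) \<Rightarrow> real set \<Rightarrow> bool" where
  "extends_across F I \<longleftrightarrow> (\<exists>G. is_extension_across F I G)"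

(* The values F x and F' x at a real point x are those of a holomorphic extension of F across
   some open interval containing x.  Neither depends on the extension or on the interval: see
   boundary_value_eq and boundary_deriv_eq below.  They carry no meaning if F has no such
   extension. *)
definition extension_at :: "(complex \<Rightarrow> complex) \<Rightarrow> real \<Rightarrow> complex \<Rightarrow> complex" where
  "extension_at F x = (SOME G. \<exists>I. open_interval I \<and> x \<in> I \<and> is_extension_across F I G)"

definition boundary_value :: "(complex \<Rightarrow> complex) \<Rightarrow> real \<Rightarrow> complex" where
  "boundary_value F x = extension_at F x (complex_of_real x)"

definition boundary_deriv :: "(complex \<Rightarrow> complex) \<Rightarrow> real \<Rightarrow> complex" where
  "boundary_deriv F x = deriv (extension_at F x) (complex_of_real x)"

lemma extensions_agree_near:
  assumes "is_extension_across F I G" "x \<in> I" "is_extension_across F J K" "x \<in> J"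
  shows "\<exists>r>0. \<forall>z\<in>ball (complex_of_real x) r. G z = K z"
proof -
  obtain U where U: "open U" "upper_half_plane \<union> complex_of_real ` I \<subseteq> U"
      "G holomorphic_on U" "\<forall>z\<in>upper_half_plane. G z = F z"
    using assms(1) unfolding is_extension_across_def by blast
  obtain V where V: "open V" "upper_half_plane \<union> complex_of_real ` J \<subseteq> V"
      "K holomorphic_on V" "\<forall>z\<in>upper_half_plane. K z = F z"
    using assms(3) unfolding is_extension_across_def by blast
  have "open (U \<inter> V)" "complex_of_real x \<in> U \<inter> V"
    using U V assms by auto
  then obtain r where r: "r > 0" "ball (complex_of_real x) r \<subseteq> U \<inter> V"
    using open_contains_ball by blast
  let ?B = "ball (complex_of_real x) r"
  have op: "open (?B \<inter> upper_half_plane)"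
    unfolding upper_half_plane_def by (intro open_Int open_ball open_halfspace_Im_gt)
  have "complex_of_real x + \<i> * complex_of_real (r/2) \<in> ?B \<inter> upper_half_plane"
    using r(1) by (simp add: upper_half_plane_def dist_norm norm_mult)
  then have ne: "?B \<inter> upper_half_plane \<noteq> {}"
    by blast
  have "G z = K z" if "z \<in> ?B" for z
  proof (rule analytic_continuation_open[where f = G and g = K, OF op open_ball ne])
    show "connected ?B" by simp
    show "?B \<inter> upper_half_plane \<subseteq> ?B" by blast
    show "G holomorphic_on ?B" "K holomorphic_on ?B"
      using U(3) V(3) r(2) by (auto intro: holomorphic_on_subset)
    show "G w = K w" if "w \<in> ?B \<inter> upper_half_plane" for w
      using that U(4) V(4) by auto
  qed (use that in auto)
  with r(1) show ?thesis by blast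
qed

lemma extension_at_agrees_near:
  assumes "open_interval I" "x \<in> I" "is_extension_across F I G"
  shows "\<exists>r>0. \<forall>z\<in>ball (complex_of_real x) r. extension_at F x z = G z"
proof -
  have "\<exists>J. open_interval J \<and> x \<in> J \<and> is_extension_across F J (extension_at F x)"
    unfolding extension_at_def
    by (rule someI_ex[where P = "\<lambda>G. \<exists>I. open_interval I \<and> x \<in> I \<and> is_extension_across F I G"])
      (use assms in blast)
  then show ?thesis
    using extensions_agree_near assms by blast
qed

lemma boundary_value_eq:
  assumes "open_interval I" "x \<in> I" "is_extension_across F I G"
  shows "boundary_value F x = G (complex_of_real x)"
  using extension_at_agrees_near[OF assms] by (auto simp: boundary_value_def)

lemma boundary_deriv_eq:
  assumes "open_interval I" "x \<in> I" "is_extension_across F I G"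
  shows "boundary_deriv F x = deriv G (complex_of_real x)"
proof -
  obtain r where "r > 0" "\<forall>z\<in>ball (complex_of_real x) r. extension_at F x z = G z"
    using extension_at_agrees_near[OF assms] by blast
  then have "\<forall>\<^sub>F z in nhds (complex_of_real x). extension_at F x z = G z"
    unfolding eventually_nhds_metric by (metis dist_commute mem_ball)
  then show ?thesis
    unfolding boundary_deriv_def by (intro deriv_cong_ev) auto
qed

end

theory Submission
  imports Defs
begin

text \<open>
  The inequality is a statement about the defect \<open>v = 1 - |F|\<^sup>2\<close>, a positive superharmonic function on
  the half-plane that vanishes on \<open>E\<close>.  The infinitesimal Schwarz--Pick inequality gives
  \<open>2 y |F'(iy)| \<le> v(iy)\<close>, so the left-hand side is at most half the integral of \<open>v\<close> along the
  imaginary axis against \<open>dy/y\<close> (\<open>schwarz_pick_deriv\<close>).  Julia's inequality gives, at \<open>x \<in> E\<close>,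
  the bound \<open>v(z) Im z \<le> 2 |F'(x)| |z - x|\<^sup>2\<close> (\<open>julia_inequality\<close>), so \<open>|F'|\<close> on \<open>E\<close> controls how
  fast \<open>v\<close> can leave \<open>0\<close>.  The passage from the boundary to the imaginary axis is a concavity argument.

  In the logarithmic coordinate \<open>w = \<rho> + i \<theta>\<close>, \<open>z = exp w\<close>, the half-plane becomes the strip
  \<open>0 < \<theta> < \<pi>\<close>, reflection in the imaginary axis becomes \<open>\<theta> \<mapsto> \<pi> - \<theta>\<close>, and \<open>dy/y\<close> becomes \<open>d\<rho>\<close>.
  Put \<open>m(\<rho>, \<theta>) = min (v(\<rho>, \<theta>)) (v(\<rho>, \<pi> - \<theta>))\<close>.  A minimum of superharmonic functions is
  superharmonic, and integrating out the translation variable \<open>\<rho>\<close> leaves a superharmonic function of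
  one variable: \<open>M(\<theta>) = \<integral> m(\<rho>, \<theta>) d\<rho>\<close> is concave on \<open>(0, \<pi>)\<close> (\<open>concave_on_ray_integrals\<close>).
  Since for almost every \<open>x > 0\<close> one of \<open>x, -x\<close> lies in \<open>E\<close>, at almost every \<open>\<rho>\<close> the minimum \<open>m\<close>
  is at most a branch of \<open>v\<close> that starts from a point of \<open>E\<close>, and Julia's inequality on the circle arc from that point gives
  \<open>M(\<theta>) \<le> 4 tan(\<theta>/2) A\<close> with \<open>A = \<integral>\<^sub>E |F'|\<close>.  A nonnegative concave function satisfies
  \<open>M(\<pi>/2) \<le> (\<pi>/2) M(\<epsilon>)/\<epsilon>\<close>, and letting \<open>\<epsilon> \<rightarrow> 0\<close> yields \<open>M(\<pi>/2) \<le> (\<pi>/2) 2 A = \<pi> A\<close>.  The two branches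
  of \<open>m\<close> agree on the imaginary axis, so the left-hand side is at most \<open>M(\<pi>/2)/2 \<le> (\<pi>/2) A\<close>.
\<close>

section \<open>Schwarz--Pick and Julia inequalities on the half-plane\<close>

lemma norm_one_minus_cnj_mult_sq: "(cmod (1 - cnj b * a))\<^sup>2 = (cmod (a - b))\<^sup>2 + (1 - (cmod a)\<^sup>2) * (1 - (cmod b)\<^sup>2)"
  unfolding cmod_power2 by (simp add: algebra_simps power2_eq_square)

lemma norm_diff_cnj_sq: "(cmod (z - cnj w))\<^sup>2 = (cmod (z - w))\<^sup>2 + 4 * Im z * Im w"
  unfolding cmod_power2 by (simp add: algebra_simps power2_eq_square)

text \<open>
  This is the contraction of the pseudo-hyperbolic distance, rearranged with the two preceding
  identities so that no denominators occur.  In this form both the infinitesimal version and the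
  boundary version are plain limits.
\<close>
lemma schwarz_pick:
  assumes F: "F holomorphic_on upper_half_plane" "F ` upper_half_plane \<subseteq> ball 0 1"
    and z: "0 < Im z" and w: "0 < Im w"
  shows "4 * Im z * Im w * (cmod (F z - F w))\<^sup>2
           \<le> (1 - (cmod (F z))\<^sup>2) * (1 - (cmod (F w))\<^sup>2) * (cmod (z - w))\<^sup>2"
proof -
  \<comment> \<open>\<open>A\<close> maps the disc onto the half-plane and takes \<open>0\<close> to \<open>w\<close>, so Schwarz's lemma applies to \<open>f\<close>.\<close>
  define A where "A = (\<lambda>\<zeta>. (w - cnj w * \<zeta>) / (1 - \<zeta>))"
  define f where "f = (\<lambda>\<zeta>. Moebius_function 0 (F w) (F (A \<zeta>)))"
  have bF: "cmod (F u) < 1" if "0 < Im u" for u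
    using F(2) that by (auto simp: upper_half_plane_def)
  have ImA: "0 < Im (A \<zeta>)" if "cmod \<zeta> < 1" for \<zeta>
  proof -
    have "(cmod \<zeta>)\<^sup>2 < 1" using that by (simp add: power_less_one_iff abs_square_less_1)
    then have *: "0 < 1 - (Re \<zeta>)\<^sup>2 - (Im \<zeta>)\<^sup>2" by (simp add: cmod_power2)
    have ne: "1 - \<zeta> \<noteq> 0" using that by auto
    have "Im (A \<zeta>) = Im w * (1 - (Re \<zeta>)\<^sup>2 - (Im \<zeta>)\<^sup>2) / (cmod (1 - \<zeta>))\<^sup>2"
      unfolding cmod_power2 by (simp add: A_def Im_divide algebra_simps power2_eq_square diff_divide_distrib add_divide_distrib)
    then show ?thesis using * w ne by simp
  qed
  have "A holomorphic_on ball 0 1"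
    unfolding A_def by (intro holomorphic_intros) auto
  then have FA: "(F \<circ> A) holomorphic_on ball 0 1"
    by (rule holomorphic_on_compose_gen[OF _ F(1)]) (auto simp: upper_half_plane_def ImA)
  have "(Moebius_function 0 (F w) \<circ> (F \<circ> A)) holomorphic_on ball 0 1"
    by (rule holomorphic_on_compose_gen[OF FA Moebius_function_holomorphic]) (use bF ImA w in auto)
  then have fh: "f holomorphic_on ball 0 1"
    by (simp add: f_def o_def)
  have f0: "f 0 = 0"
    by (simp add: f_def A_def Moebius_function_eq_zero)
  have fb: "cmod (f \<zeta>) < 1" if "cmod \<zeta> < 1" for \<zeta>
    unfolding f_def using bF w ImA[OF that] by (intro Moebius_function_norm_lt_1) auto
  define \<zeta> where "\<zeta> = (z - w) / (z - cnj w)"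
  have ne: "z - cnj w \<noteq> 0"
    using z w by (auto simp: complex_eq_iff)
  have "(cmod (z - w))\<^sup>2 < (cmod (z - cnj w))\<^sup>2"
    using z w by (simp add: norm_diff_cnj_sq)
  then have lt: "cmod (z - w) < cmod (z - cnj w)"
    by (simp add: power2_less_imp_less)
  then have \<zeta>1: "cmod \<zeta> < 1"
    using ne by (simp add: \<zeta>_def norm_divide divide_simps)
  have "1 - \<zeta> = (w - cnj w) / (z - cnj w)" "w - cnj w * \<zeta> = z * (w - cnj w) / (z - cnj w)"
    using ne by (simp_all add: \<zeta>_def field_simps)
  moreover have "w - cnj w \<noteq> 0" using w by (auto simp: complex_eq_iff)
  ultimately have "A \<zeta> = z"
    using ne by (simp add: A_def)
  then have "cmod ((F z - F w) / (1 - cnj (F w) * F z)) \<le> cmod ((z - w) / (z - cnj w))"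
    using Schwarz_Lemma(1)[OF fh f0 fb \<zeta>1]
    by (simp add: f_def \<zeta>_def Moebius_function_simple)
  moreover have "1 - cnj (F w) * F z \<noteq> 0"
  proof
    assume "1 - cnj (F w) * F z = 0"
    then have "cmod (F w) * cmod (F z) = 1"
      by (metis complex_mod_cnj eq_iff_diff_eq_0 norm_mult norm_one)
    moreover have "cmod (F w) * cmod (F z) < 1 * 1"
      using bF[OF z] bF[OF w] by (intro mult_strict_mono') auto
    ultimately show False by simp
  qed
  ultimately have "cmod (F z - F w) * cmod (z - cnj w) \<le> cmod (z - w) * cmod (1 - cnj (F w) * F z)"
    using ne by (simp add: norm_divide divide_simps mult.commute)
  then have "(cmod (F z - F w) * cmod (z - cnj w))\<^sup>2 \<le> (cmod (z - w) * cmod (1 - cnj (F w) * F z))\<^sup>2"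
    by (intro power_mono) auto
  then show ?thesis
    unfolding power_mult_distrib norm_one_minus_cnj_mult_sq norm_diff_cnj_sq by (simp add: algebra_simps)
qed

corollary schwarz_pick_deriv:
  assumes F: "F holomorphic_on upper_half_plane" "F ` upper_half_plane \<subseteq> ball 0 1"
    and z: "0 < Im z"
  shows "2 * Im z * cmod (deriv F z) \<le> 1 - (cmod (F z))\<^sup>2"
proof -
  have op: "open upper_half_plane"
    unfolding upper_half_plane_def by (rule open_halfspace_Im_gt)
  have zU: "z \<in> upper_half_plane" using z by (simp add: upper_half_plane_def)
  have d: "(F has_field_derivative deriv F z) (at z)"
    using F(1) op zU holomorphic_derivI by blast
  then have cF: "(F \<longlongrightarrow> F z) (at z)"
    using DERIV_isCont isContD by blast
  have dq: "((\<lambda>w. (F w - F z) / (w - z)) \<longlongrightarrow> deriv F z) (at z)"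
    using d by (simp add: has_field_derivative_iff)
  have "\<forall>\<^sub>F w in at z. w \<in> upper_half_plane \<and> w \<noteq> z"
    using eventually_at_in_open'[OF op zU] by (auto simp: eventually_at_filter)
  then have ev: "\<forall>\<^sub>F w in at z. 4 * Im z * Im w * (cmod ((F w - F z) / (w - z)))\<^sup>2
        \<le> (1 - (cmod (F z))\<^sup>2) * (1 - (cmod (F w))\<^sup>2)"
  proof eventually_elim
    case (elim w)
    then show ?case
      using schwarz_pick[OF F z, of w]
      by (simp add: norm_divide power_divide divide_simps upper_half_plane_def norm_minus_commute)
  qed
  have "((\<lambda>w. 4 * Im z * Im w * (cmod ((F w - F z) / (w - z)))\<^sup>2) \<longlongrightarrow> 4 * Im z * Im z * (cmod (deriv F z))\<^sup>2) (at z)"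
    by (intro tendsto_intros dq)
  moreover have "((\<lambda>w. (1 - (cmod (F z))\<^sup>2) * (1 - (cmod (F w))\<^sup>2)) \<longlongrightarrow> (1 - (cmod (F z))\<^sup>2) * (1 - (cmod (F z))\<^sup>2)) (at z)"
    by (intro tendsto_intros cF)
  ultimately have "4 * Im z * Im z * (cmod (deriv F z))\<^sup>2 \<le> (1 - (cmod (F z))\<^sup>2) * (1 - (cmod (F z))\<^sup>2)"
    using ev tendsto_le[OF trivial_limit_at] by blast
  then have "(2 * Im z * cmod (deriv F z))\<^sup>2 \<le> (1 - (cmod (F z))\<^sup>2)\<^sup>2"
    by (simp add: power2_eq_square algebra_simps)
  moreover have "0 \<le> 1 - (cmod (F z))\<^sup>2"
    using F(2) zU by (force simp: power_le_one)
  ultimately show ?thesis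
    by (rule power2_le_imp_le)
qed

text \<open>
  Divide the Schwarz--Pick inequality by the height of its second point and let that point descend
  vertically to \<open>x\<close>.  The defect of that point divided by its height is at most \<open>2 |G'(x)|\<close> in the
  limit, and \<open>|F z - G x|\<close> is at least \<open>1 - |F z|\<close>, hence at least half the defect at \<open>z\<close>.
\<close>
lemma julia_inequality:
  fixes x :: real
  assumes F: "F holomorphic_on upper_half_plane" "F ` upper_half_plane \<subseteq> ball 0 1"
    and G: "(G has_field_derivative G') (at (complex_of_real x))"
           "\<And>z. 0 < Im z \<Longrightarrow> G z = F z" "cmod (G x) = 1"
    and z: "0 < Im z"
  shows "(1 - (cmod (F z))\<^sup>2) * Im z \<le> 2 * cmod G' * (cmod (z - x))\<^sup>2"
proof -
  define p where "p = (\<lambda>\<epsilon>. complex_of_real x + \<i> * complex_of_real \<epsilon>)"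
  have lim_p: "filterlim p (at (complex_of_real x)) (at_right 0)"
    unfolding filterlim_at
  proof
    show "\<forall>\<^sub>F \<epsilon> in at_right 0. p \<epsilon> \<in> UNIV \<and> p \<epsilon> \<noteq> complex_of_real x"
      by (auto simp: p_def eventually_at_filter)
    have "((\<lambda>\<epsilon>. complex_of_real x + \<i> * complex_of_real \<epsilon>) \<longlongrightarrow> complex_of_real x + \<i> * complex_of_real 0) (at_right 0)"
      by (intro tendsto_intros)
    then show "(p \<longlongrightarrow> complex_of_real x) (at_right 0)"
      by (simp add: p_def[abs_def])
  qed
  have "isCont G (complex_of_real x)" using G(1) DERIV_isCont by blast
  then have limG: "((\<lambda>\<epsilon>. G (p \<epsilon>)) \<longlongrightarrow> G x) (at_right 0)"
    using lim_p filterlim_compose isContD by blast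
  have "((\<lambda>w. (G w - G x) / (w - x)) \<longlongrightarrow> G') (at (complex_of_real x))"
    using G(1) by (simp add: has_field_derivative_iff)
  then have limD: "((\<lambda>\<epsilon>. (G (p \<epsilon>) - G x) / (p \<epsilon> - x)) \<longlongrightarrow> G') (at_right 0)"
    using lim_p filterlim_compose by blast
  have limp: "(p \<longlongrightarrow> complex_of_real x) (at_right 0)"
    using lim_p filterlim_at by blast
  have bF: "cmod (F u) < 1" if "0 < Im u" for u
    using F(2) that by (auto simp: upper_half_plane_def)
  define v where "v = 1 - (cmod (F z))\<^sup>2"
  have v0: "0 < v" using bF[OF z] by (simp add: v_def abs_square_less_1)
  have ev: "\<forall>\<^sub>F \<epsilon> in at_right 0. 4 * Im z * (cmod (F z - G (p \<epsilon>)))\<^sup>2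
      \<le> v * (cmod ((G (p \<epsilon>) - G x) / (p \<epsilon> - x)) * (1 + cmod (G (p \<epsilon>)))) * (cmod (z - p \<epsilon>))\<^sup>2"
    using eventually_at_right_less[of "0::real"]
  proof eventually_elim
    case (elim \<epsilon>)
    define q where "q = G (p \<epsilon>)"
    have Imp: "Im (p \<epsilon>) = \<epsilon>" by (simp add: p_def)
    have q: "q = F (p \<epsilon>)" using G(2) Imp elim by (simp add: q_def)
    have "4 * Im z * \<epsilon> * (cmod (F z - q))\<^sup>2 \<le> v * (1 - (cmod q)\<^sup>2) * (cmod (z - p \<epsilon>))\<^sup>2"
      using schwarz_pick[OF F z, of "p \<epsilon>"] Imp elim by (simp add: q v_def)
    also have "1 - (cmod q)\<^sup>2 = (cmod (G x) - cmod q) * (1 + cmod q)"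
      by (simp add: G(3) power2_eq_square algebra_simps)
    also have "\<dots> \<le> cmod (q - G x) * (1 + cmod q)"
      using norm_triangle_ineq2[of "G x" q] by (intro mult_right_mono) (auto simp: norm_minus_commute)
    finally have *: "4 * Im z * \<epsilon> * (cmod (F z - q))\<^sup>2 \<le> v * (cmod (q - G x) * (1 + cmod q)) * (cmod (z - p \<epsilon>))\<^sup>2"
      using v0 by (simp add: mult_left_mono mult_right_mono)
    have d: "cmod ((q - G x) / (p \<epsilon> - x)) = cmod (q - G x) / \<epsilon>"
      using elim by (simp add: p_def norm_divide norm_mult)
    have "4 * Im z * (cmod (F z - q))\<^sup>2 = (4 * Im z * \<epsilon> * (cmod (F z - q))\<^sup>2) / \<epsilon>"
      using elim by simp
    also have "\<dots> \<le> (v * (cmod (q - G x) * (1 + cmod q)) * (cmod (z - p \<epsilon>))\<^sup>2) / \<epsilon>"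
      using * elim by (intro divide_right_mono) auto
    also have "\<dots> = v * (cmod (q - G x) / \<epsilon> * (1 + cmod q)) * (cmod (z - p \<epsilon>))\<^sup>2"
      by simp
    finally show ?case
      unfolding q_def[symmetric] d .
  qed
  have l1: "((\<lambda>\<epsilon>. 4 * Im z * (cmod (F z - G (p \<epsilon>)))\<^sup>2) \<longlongrightarrow> 4 * Im z * (cmod (F z - G x))\<^sup>2) (at_right 0)"
    by (intro tendsto_intros limG)
  have l2: "((\<lambda>\<epsilon>. v * (cmod ((G (p \<epsilon>) - G x) / (p \<epsilon> - x)) * (1 + cmod (G (p \<epsilon>)))) * (cmod (z - p \<epsilon>))\<^sup>2)
       \<longlongrightarrow> v * (cmod G' * (1 + cmod (G x))) * (cmod (z - x))\<^sup>2) (at_right 0)"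
    by (intro tendsto_intros limG limD limp)
  have "4 * Im z * (cmod (F z - G x))\<^sup>2 \<le> v * (cmod G' * 2) * (cmod (z - x))\<^sup>2"
    using tendsto_le[OF _ l2 l1 ev] G(3) by simp
  moreover have "v / 2 \<le> cmod (F z - G x)"
  proof -
    have "v = (1 - cmod (F z)) * (1 + cmod (F z))"
      by (simp add: v_def power2_eq_square algebra_simps)
    also have "\<dots> \<le> (1 - cmod (F z)) * 2"
      using bF[OF z] by (intro mult_left_mono) auto
    also have "1 - cmod (F z) \<le> cmod (F z - G x)"
      using norm_triangle_ineq2[of "G x" "F z"] G(3) by (simp add: norm_minus_commute)
    finally show ?thesis by simp
  qed
  then have "(v / 2)\<^sup>2 \<le> (cmod (F z - G x))\<^sup>2"
    using v0 by (intro power_mono) auto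
  ultimately have "4 * Im z * (v / 2)\<^sup>2 \<le> v * (cmod G' * 2) * (cmod (z - x))\<^sup>2"
    using z by (smt (verit, best) mult_left_mono)
  then have "v * (v * Im z) \<le> v * (2 * cmod G' * (cmod (z - x))\<^sup>2)"
    by (simp add: power2_eq_square algebra_simps)
  then show ?thesis
    using v0 by (simp add: v_def)
qed

section \<open>Circle means and integral transformations\<close>

text \<open>
  The value of \<open>f\<^sup>2\<close> at the centre is its mean over the circle, so \<open>|f|\<^sup>2\<close> at the centre is at most the
  mean of \<open>|f|\<^sup>2\<close>: the defect is superharmonic.
\<close>
lemma circle_mean_one_minus_norm_sq:
  assumes f: "f holomorphic_on cball c r" and r: "0 < r" and b: "\<And>z. z \<in> cball c r \<Longrightarrow> cmod (f z) \<le> 1"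
  shows "(\<integral>\<^sup>+t\<in>{0..1}. ennreal (1 - (cmod (f (c + r * cis (2 * pi * t))))\<^sup>2) \<partial>lborel) \<le> ennreal (1 - (cmod (f c))\<^sup>2)"
proof -
  define g where "g = (\<lambda>t::real. c + r * cis (2 * pi * t))"
  have g: "circlepath c r = g"
    by (simp add: g_def circlepath cis_conv_exp mult_ac)
  have gc: "g t \<in> cball c r" for t
    using r by (simp add: g_def dist_norm norm_mult)
  have cg: "continuous_on A g" for A
    unfolding g_def cis_conv_exp by (intro continuous_intros)
  have "(\<lambda>z. (f z)\<^sup>2) holomorphic_on cball c r"
    using f by (intro holomorphic_intros)
  then have "((\<lambda>u. (f u)\<^sup>2 / (u - c)) has_contour_integral (2 * of_real pi * \<i> * (f c)\<^sup>2)) (circlepath c r)"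
    by (rule Cauchy_integral_circlepath_simple) (use r in simp)
  moreover have "vector_derivative g (at t) = 2 * pi * \<i> * r * exp (2 * of_real pi * \<i> * t)" for t
    using vector_derivative_circlepath[of c r t] unfolding g .
  ultimately have "((\<lambda>t. (f (g t))\<^sup>2 / (g t - c) * (2 * pi * \<i> * r * exp (2 * of_real pi * \<i> * t)))
       has_integral (2 * of_real pi * \<i> * (f c)\<^sup>2)) {0..1}"
    unfolding has_contour_integral g by simp
  moreover have "(f (g t))\<^sup>2 / (g t - c) * (2 * pi * \<i> * r * exp (2 * of_real pi * \<i> * t)) = 2 * of_real pi * \<i> * (f (g t))\<^sup>2" for t
    using r by (simp add: g_def cis_conv_exp field_simps)
  ultimately have "((\<lambda>t. 2 * of_real pi * \<i> * (f (g t))\<^sup>2) has_integral (2 * of_real pi * \<i> * (f c)\<^sup>2)) {0..1}"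
    by simp
  then have "((\<lambda>t. (1 / (2 * of_real pi * \<i>)) * (2 * of_real pi * \<i> * (f (g t))\<^sup>2)) has_integral (1 / (2 * of_real pi * \<i>)) * (2 * of_real pi * \<i> * (f c)\<^sup>2)) {0..1}"
    by (rule has_integral_mult_right)
  then have hi: "((\<lambda>t. (f (g t))\<^sup>2) has_integral (f c)\<^sup>2) {0..1}"
    by simp
  have cfg: "continuous_on {0..1} (\<lambda>t. f (g t))"
    by (rule continuous_on_compose2[OF holomorphic_on_imp_continuous_on[OF f] cg]) (use gc in auto)
  define v where "v = (\<lambda>t. 1 - (cmod (f (g t)))\<^sup>2)"
  have cv: "continuous_on {0..1} v"
    unfolding v_def using cfg by (intro continuous_intros)
  have vnn: "0 \<le> v t" for t
    using b[OF gc] by (simp add: v_def power_le_one)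
  have sv: "set_integrable lborel {0..1} v"
    using cv by (rule borel_integrable_atLeastAtMost')
  have ci: "(\<lambda>t. (cmod (f (g t)))\<^sup>2) integrable_on {0..1}"
    using cfg by (intro integrable_continuous_real continuous_intros)
  have "cmod ((f c)\<^sup>2) \<le> integral {0..1} (\<lambda>t. (cmod (f (g t)))\<^sup>2)"
    using integral_norm_bound_integral[OF has_integral_integrable[OF hi] ci] integral_unique[OF hi]
    by (simp add: norm_power)
  moreover have "integral {0..1} v = 1 - integral {0..1} (\<lambda>t. (cmod (f (g t)))\<^sup>2)"
    unfolding v_def using ci by (subst integral_diff) auto
  ultimately have le: "(LINT t:{0..1}|lborel. v t) \<le> 1 - (cmod (f c))\<^sup>2"
    using set_borel_integral_eq_integral(2)[OF sv] by (simp add: norm_power)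
  have "(\<integral>\<^sup>+t\<in>{0..1}. ennreal (v t) \<partial>lborel) = (\<integral>\<^sup>+t. ennreal (indicator {0..1} t *\<^sub>R v t) \<partial>lborel)"
    by (intro nn_integral_cong) (auto simp: indicator_def)
  also have "\<dots> = ennreal (LINT t:{0..1}|lborel. v t)"
    unfolding set_lebesgue_integral_def using sv vnn
    by (intro nn_integral_eq_integral) (auto simp: set_integrable_def)
  also have "\<dots> \<le> ennreal (1 - (cmod (f c))\<^sup>2)"
    using le by (rule ennreal_leI)
  finally show ?thesis
    by (simp add: v_def g_def)
qed

lemma nn_integral_exp_substitution:
  fixes f :: "real \<Rightarrow> ennreal"
  assumes [measurable]: "f \<in> borel_measurable borel"
  shows "(\<integral>\<^sup>+x\<in>{0<..}. f x \<partial>lborel) = (\<integral>\<^sup>+\<rho>. f (exp \<rho>) * ennreal (exp \<rho>) \<partial>lborel)"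
proof -
  \<comment> \<open>The successor keeps every interval \<open>[- n k, n k]\<close> nondegenerate, as the substitution on compact
    intervals requires.\<close>
  define n where "n = (\<lambda>k. real (Suc k))"
  have sup1: "(SUP k. f x * indicator {exp (- n k)..exp (n k)} x) = f x * indicator {0<..} x" for x
  proof (cases "0 < x")
    case True
    obtain k where "\<bar>ln x\<bar> \<le> real k"
      using real_arch_simple by blast
    then have k: "\<bar>ln x\<bar> \<le> n k"
      by (simp add: n_def)
    have "exp (- n k) \<le> exp (ln x)" "exp (ln x) \<le> exp (n k)"
      using k by auto
    then have "x \<in> {exp (- n k)..exp (n k)}" using True by simp
    then show ?thesis
      using True by (intro antisym SUP_least SUP_upper2[of k]) (auto simp: indicator_def)
  next
    case False
    then have "x \<notin> {exp (- n k)..exp (n k)}" for k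
      by (meson atLeastAtMost_iff exp_gt_zero less_le_trans)
    then show ?thesis using False by simp
  qed
  have sup2: "(SUP k. f (exp \<rho>) * ennreal (exp \<rho>) * indicator {- n k..n k} \<rho>) = f (exp \<rho>) * ennreal (exp \<rho>)" for \<rho>
  proof -
    obtain k where "\<bar>\<rho>\<bar> \<le> real k"
      using real_arch_simple by blast
    then have k: "\<bar>\<rho>\<bar> \<le> n k"
      by (simp add: n_def)
    then show ?thesis
      by (intro antisym SUP_least SUP_upper2[of k]) (auto simp: indicator_def)
  qed
  have sub: "(\<integral>\<^sup>+x. f x * indicator {exp (- n k)..exp (n k)} x \<partial>lborel)
      = (\<integral>\<^sup>+\<rho>. f (exp \<rho>) * ennreal (exp \<rho>) * indicator {- n k..n k} \<rho> \<partial>lborel)" for k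
    by (rule nn_integral_substitution_aux)
      (auto simp: n_def intro!: derivative_eq_intros continuous_intros)
  have "(\<integral>\<^sup>+x\<in>{0<..}. f x \<partial>lborel) = (SUP k. \<integral>\<^sup>+x. f x * indicator {exp (- n k)..exp (n k)} x \<partial>lborel)"
    unfolding sup1[symmetric]
  proof (rule nn_integral_monotone_convergence_SUP)
    show "incseq (\<lambda>k x. f x * indicator {exp (- n k)..exp (n k)} x)"
    proof (intro incseq_SucI le_funI mult_left_mono)
      fix k x
      have "exp (n k) \<le> exp (n (Suc k))" "exp (- n (Suc k)) \<le> exp (- n k)"
        by (simp_all add: n_def)
      then show "indicator {exp (- n k)..exp (n k)} x \<le> (indicator {exp (- n (Suc k))..exp (n (Suc k))} x :: ennreal)"
        by (simp add: indicator_def del: exp_le_cancel_iff)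
    qed auto
  qed simp
  also have "\<dots> = (SUP k. \<integral>\<^sup>+\<rho>. f (exp \<rho>) * ennreal (exp \<rho>) * indicator {- n k..n k} \<rho> \<partial>lborel)"
    unfolding sub ..
  also have "\<dots> = (\<integral>\<^sup>+\<rho>. (SUP k. f (exp \<rho>) * ennreal (exp \<rho>) * indicator {- n k..n k} \<rho>) \<partial>lborel)"
  proof (rule nn_integral_monotone_convergence_SUP[symmetric])
    show "incseq (\<lambda>k \<rho>. f (exp \<rho>) * ennreal (exp \<rho>) * indicator {- n k..n k} \<rho>)"
      by (intro incseq_SucI le_funI mult_left_mono) (auto simp: indicator_def n_def)
  qed simp
  finally show ?thesis
    unfolding sup2 .
qed

lemma nn_integral_fold:
  fixes h :: "real \<Rightarrow> ennreal"
  assumes [measurable]: "h \<in> borel_measurable borel"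
  shows "(\<integral>\<^sup>+x. h x \<partial>lborel) = (\<integral>\<^sup>+x\<in>{0<..}. (h x + h (- x)) \<partial>lborel)"
proof -
  have "(\<integral>\<^sup>+x. h x \<partial>lborel) = (\<integral>\<^sup>+x. h x * indicator {0<..} x + h x * indicator {..<0} x \<partial>lborel)"
  proof (rule nn_integral_cong_AE)
    show "AE x in lborel. h x = h x * indicator {0<..} x + h x * indicator {..<0} x"
      using AE_lborel_singleton[of 0] by eventually_elim (auto simp: indicator_def)
  qed
  also have "\<dots> = (\<integral>\<^sup>+x\<in>{0<..}. h x \<partial>lborel) + (\<integral>\<^sup>+x\<in>{..<0}. h x \<partial>lborel)"
    by (rule nn_integral_add) auto
  also have "(\<integral>\<^sup>+x\<in>{..<0}. h x \<partial>lborel) = (\<integral>\<^sup>+x. h (- x) * indicator {0<..} x \<partial>lborel)"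
    by (subst nn_integral_real_affine[of _ "-1" 0]) (auto simp: indicator_def intro!: nn_integral_cong)
  also have "(\<integral>\<^sup>+x\<in>{0<..}. h x \<partial>lborel) + \<dots> = (\<integral>\<^sup>+x. h x * indicator {0<..} x + h (- x) * indicator {0<..} x \<partial>lborel)"
    by (rule nn_integral_add[symmetric]) auto
  finally show ?thesis by (simp add: distrib_right)
qed

section \<open>Concavity of integrals of superharmonic functions\<close>

lemma has_integral_quadratic_sin:
  "((\<lambda>t. a + b * sin (2 * pi * t) + c * (sin (2 * pi * t))\<^sup>2) has_integral (a + c / 2)) {0..1}"
proof -
  define P where "P = (\<lambda>t. (a + c / 2) * t - b * cos (2 * pi * t) / (2 * pi) - c * sin (4 * pi * t) / (8 * pi))"
  have cs: "cos (4 * pi * t) = 1 - 2 * (sin (2 * pi * t))\<^sup>2" for t :: real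
    using cos_double_sin[of "2 * pi * t"] by (simp add: mult.assoc)
  have "(P has_real_derivative (a + b * sin (2 * pi * t) + c * (sin (2 * pi * t))\<^sup>2)) (at t within {0..1})" for t
  proof -
    have "(P has_real_derivative ((a + c / 2) - b * (- sin (2 * pi * t) * (2 * pi)) / (2 * pi)
        - c * (cos (4 * pi * t) * (4 * pi)) / (8 * pi))) (at t within {0..1})"
      unfolding P_def by (auto intro!: derivative_eq_intros)
    moreover have "c * (cos (4 * pi * t) * (4 * pi)) / (8 * pi) = c / 2 - c * (sin (2 * pi * t))\<^sup>2"
      unfolding cs by (simp add: field_simps)
    ultimately show ?thesis by (simp add: add.assoc)
  qed
  then have "((\<lambda>t. a + b * sin (2 * pi * t) + c * (sin (2 * pi * t))\<^sup>2) has_integral (P 1 - P 0)) {0..1}"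
    by (intro fundamental_theorem_of_calculus) (auto simp: has_real_derivative_iff_has_vector_derivative)
  moreover have "sin (4 * pi) = 0"
    using sin_npi[of 4] by (simp add: mult.commute)
  then have "P 1 - P 0 = a + c / 2"
    by (simp add: P_def)
  ultimately show ?thesis by simp
qed

text \<open>
  The heights of the points of a circle are \<open>x + r sin (2 \<pi> t)\<close>, so this is superharmonicity for a
  function of the height alone.  If \<open>f\<close> fell below a chord, it would also fall below a slightly
  convex parabola \<open>q\<close> with the same ends; at a minimum of \<open>f - q\<close>, which exists by lower
  semicontinuity, the mean of \<open>f\<close> exceeds its value by at least the mean of the quadratic part of \<open>q\<close>.
\<close>
lemma concave_on_super_mean:
  fixes f :: "real \<Rightarrow> real"
  assumes nn: "\<And>x. x \<in> {a<..<b} \<Longrightarrow> 0 \<le> f x"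
    and lsc: "\<And>s x l. \<lbrakk>\<And>n. s n \<in> {a<..<b}; x \<in> {a<..<b}; s \<longlonglongrightarrow> x; (\<lambda>n. f (s n)) \<longlonglongrightarrow> l\<rbrakk> \<Longrightarrow> f x \<le> l"
    and int: "\<And>x r. \<lbrakk>0 < r; a < x - r; x + r < b\<rbrakk> \<Longrightarrow> set_integrable lborel {0..1} (\<lambda>t. f (x + r * sin (2 * pi * t)))"
    and mean: "\<And>x r. \<lbrakk>0 < r; a < x - r; x + r < b\<rbrakk> \<Longrightarrow> (LINT t:{0..1}|lborel. f (x + r * sin (2 * pi * t))) \<le> f x"
  shows "concave_on {a<..<b} f"
proof (rule concave_on_linorderI)
  fix t x y :: real
  assume t: "0 < t" "t < 1" and xy: "x \<in> {a<..<b}" "y \<in> {a<..<b}" "x < y"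
  define p where "p = (1 - t) * x + t * y"
  define \<sigma> where "\<sigma> = (f y - f x) / (y - x)"
  define L where "L = (\<lambda>\<theta>. f x + \<sigma> * (\<theta> - x))"
  have px: "p - x = t * (y - x)" and yp: "y - p = (1 - t) * (y - x)"
    by (simp_all add: p_def algebra_simps)
  have pxy: "x < p" "p < y"
    using t xy px yp by (smt (verit) mult_pos_pos)+
  have "L p = f x + (f y - f x) * t"
    using xy by (simp add: L_def px \<sigma>_def)
  then have Lp: "L p = (1 - t) * f x + t * f y"
    by (simp add: algebra_simps)
  have "L p \<le> f p"
  proof (rule ccontr)
    assume "\<not> L p \<le> f p"
    then have less: "f p < L p" by simp
    \<comment> \<open>This curvature halves the gap between \<open>f\<close> and the chord at \<open>p\<close>, so \<open>q\<close> still lies above \<open>f\<close> there.\<close>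
    define \<kappa> where "\<kappa> = (L p - f p) / (2 * ((p - x) * (y - p)))"
    define q where "q = (\<lambda>\<theta>. L \<theta> + \<kappa> * (\<theta> - x) * (\<theta> - y))"
    define N where "N = (\<lambda>\<theta>. f \<theta> - q \<theta>)"
    have \<kappa>: "0 < \<kappa>"
      using less pxy by (simp add: \<kappa>_def)
    have "\<kappa> * ((p - x) * (y - p)) = (L p - f p) / 2"
      using pxy by (simp add: \<kappa>_def)
    moreover have "\<kappa> * (p - x) * (p - y) = - (\<kappa> * ((p - x) * (y - p)))"
      by (simp add: algebra_simps)
    ultimately have "q p = L p - (L p - f p) / 2"
      by (simp add: q_def)
    then have Np: "N p < 0"
      using less by (simp add: N_def field_simps)
    have Nx: "N x = 0" and Ny: "N y = 0"
      using xy by (simp_all add: N_def q_def L_def \<sigma>_def)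
    have cq: "continuous_on UNIV q"
      unfolding q_def L_def by (intro continuous_intros)
    have sub: "{x..y} \<subseteq> {a<..<b}" using xy by auto
    have "bounded (q ` {x..y})"
      using cq by (intro compact_imp_bounded compact_continuous_image) (auto intro: continuous_on_subset)
    then obtain K where K: "\<And>\<theta>. \<theta> \<in> {x..y} \<Longrightarrow> \<bar>q \<theta>\<bar> \<le> K"
      unfolding bounded_iff by (metis image_eqI real_norm_def)
    have bd: "bdd_below (N ` {x..y})"
    proof (rule bdd_belowI2)
      show "- K \<le> N \<theta>" if "\<theta> \<in> {x..y}" for \<theta>
        using K[OF that] nn[of \<theta>] sub that by (auto simp: N_def)
    qed
    define I where "I = Inf (N ` {x..y})"
    have "\<exists>\<theta>\<in>{x..y}. N \<theta> < I + inverse (real (Suc n))" for n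
      using cInf_lessD[of "N ` {x..y}" "I + inverse (real (Suc n))"] xy by (auto simp: I_def)
    then obtain s where s: "\<And>n. s n \<in> {x..y}" "\<And>n. N (s n) < I + inverse (real (Suc n))"
      by metis
    have Ilow: "I \<le> N \<theta>" if "\<theta> \<in> {x..y}" for \<theta>
      unfolding I_def using bd that by (intro cInf_lower) auto
    have lim: "(\<lambda>n. I + inverse (real (Suc n))) \<longlonglongrightarrow> I"
      using LIMSEQ_inverse_real_of_nat_add by simp
    have NI: "(\<lambda>n. N (s n)) \<longlonglongrightarrow> I"
    proof (rule tendsto_sandwich[OF _ _ tendsto_const lim])
      show "\<forall>\<^sub>F n in sequentially. I \<le> N (s n)"
        using Ilow s(1) by (intro always_eventually) blast
      show "\<forall>\<^sub>F n in sequentially. N (s n) \<le> I + inverse (real (Suc n))"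
        using s(2) by (intro always_eventually allI less_imp_le)
    qed
    obtain z k where z: "z \<in> {x..y}" and k: "strict_mono k" and sz: "(s \<circ> k) \<longlonglongrightarrow> z"
      using compact_imp_seq_compact[OF compact_Icc, of x y] s(1) unfolding seq_compact_def by metis
    have "(\<lambda>n. N ((s \<circ> k) n) + q ((s \<circ> k) n)) \<longlonglongrightarrow> I + q z"
    proof (rule tendsto_add)
      show "(\<lambda>n. N ((s \<circ> k) n)) \<longlonglongrightarrow> I"
        using LIMSEQ_subseq_LIMSEQ[OF NI k] by (simp add: o_def)
      show "(\<lambda>n. q ((s \<circ> k) n)) \<longlonglongrightarrow> q z"
        using continuous_on_tendsto_compose[OF cq sz] by simp
    qed
    then have "(\<lambda>n. f ((s \<circ> k) n)) \<longlonglongrightarrow> I + q z"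
      by (simp add: N_def)
    then have "f z \<le> I + q z"
    proof (rule lsc[rotated 3])
      show "(s \<circ> k) n \<in> {a<..<b}" for n
        using s(1)[of "k n"] sub by (simp add: subset_iff)
      show "z \<in> {a<..<b}"
        using z sub by blast
    qed (rule sz)
    then have zmin: "N z \<le> N \<theta>" if "\<theta> \<in> {x..y}" for \<theta>
      using Ilow[OF that] by (simp add: N_def)
    have "N z < 0"
      using zmin[of p] Np pxy by simp
    then have zxy: "x < z" "z < y"
      using z Nx Ny by (auto simp: less_le)
    \<comment> \<open>Any radius that keeps \<open>[z - r, z + r]\<close> inside \<open>[x, y]\<close>, where \<open>z\<close> is a minimum, would do.\<close>
    define r where "r = min (z - x) (y - z)"
    have r: "0 < r" "a < z - r" "z + r < b" "x \<le> z - r" "z + r \<le> y"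
      using zxy xy by (auto simp: r_def)
    define g where "g = (\<lambda>t. f z + (\<sigma> + \<kappa> * (2 * z - x - y)) * r * sin (2 * pi * t) + \<kappa> * r\<^sup>2 * (sin (2 * pi * t))\<^sup>2)"
    have low: "g t \<le> f (z + r * sin (2 * pi * t))" for t
    proof -
      have "r * \<bar>sin (2 * pi * t)\<bar> \<le> r * 1"
        using r(1) by (intro mult_left_mono) auto
      then have "\<bar>r * sin (2 * pi * t)\<bar> \<le> r"
        using r(1) by (simp add: abs_mult)
      then have "z + r * sin (2 * pi * t) \<in> {x..y}"
        using r unfolding atLeastAtMost_iff by linarith
      then have "N z \<le> N (z + r * sin (2 * pi * t))"
        by (rule zmin)
      moreover have "q (z + u) = q z + (\<sigma> + \<kappa> * (2 * z - x - y)) * u + \<kappa> * u\<^sup>2" for u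
        by (simp add: q_def L_def algebra_simps power2_eq_square)
      ultimately show ?thesis
        by (simp add: N_def g_def power_mult_distrib mult.assoc)
    qed
    have hg: "(g has_integral (f z + \<kappa> * r\<^sup>2 / 2)) {0..1}"
      unfolding g_def by (rule has_integral_quadratic_sin)
    have gi: "set_integrable lborel {0..1} g"
      unfolding g_def by (intro borel_integrable_atLeastAtMost' continuous_intros)
    have "f z + \<kappa> * r\<^sup>2 / 2 = (LINT t:{0..1}|lborel. g t)"
      using set_borel_integral_eq_integral(2)[OF gi] integral_unique[OF hg] by simp
    also have "\<dots> \<le> (LINT t:{0..1}|lborel. f (z + r * sin (2 * pi * t)))"
      using gi int r(1,2,3) low by (intro set_integral_mono)
    also have "\<dots> \<le> f z"
      using mean r(1,2,3) by blast
    finally show False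
      using \<kappa> r(1) by (simp add: mult_le_0_iff)
  qed
  then show "(1 - t) * f x + t * f y \<le> f ((1 - t) *\<^sub>R x + t *\<^sub>R y)"
    unfolding Lp by (simp add: p_def)
qed simp

text \<open>
  Integrating the circle inequality over all centres of the same height removes the horizontal
  coordinate, because Lebesgue measure on a line is translation invariant.  Continuity of
  \<open>M\<close> is only a consequence of its concavity; the lower semicontinuity that the concavity criterion
  asks for comes from Fatou's lemma.
\<close>
lemma concave_on_line_integrals:
  fixes m :: "complex \<Rightarrow> real" and B :: real
  defines "S \<equiv> {w. 0 < Im w \<and> Im w < B}"
    and "M \<equiv> (\<lambda>\<theta>. \<integral>\<^sup>+\<rho>. ennreal (m (Complex \<rho> \<theta>)) \<partial>lborel)"
  assumes cont: "continuous_on S m"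
    and mean: "\<And>c r. \<lbrakk>0 < r; cball c r \<subseteq> S\<rbrakk> \<Longrightarrow>
                 (\<integral>\<^sup>+t\<in>{0..1}. ennreal (m (c + r * cis (2 * pi * t))) \<partial>lborel) \<le> ennreal (m c)"
    and fin: "\<And>\<theta>. \<lbrakk>0 < \<theta>; \<theta> < B\<rbrakk> \<Longrightarrow> M \<theta> < \<infinity>"
  shows "concave_on {0<..<B} (\<lambda>\<theta>. enn2real (M \<theta>))"
proof (rule concave_on_super_mean)
  have mcont: "continuous_on UNIV (\<lambda>\<rho>. m (Complex \<rho> \<theta>))" if "0 < \<theta>" "\<theta> < B" for \<theta>
    by (rule continuous_on_compose2[OF cont]) (use that in \<open>auto simp: S_def Complex_eq intro!: continuous_intros\<close>)
  then have meas: "(\<lambda>\<rho>. ennreal (m (Complex \<rho> \<theta>))) \<in> borel_measurable borel" if "0 < \<theta>" "\<theta> < B" for \<theta>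
    using that borel_measurable_continuous_onI by (intro measurable_compose[OF _ measurable_ennreal]) blast
  show "0 \<le> enn2real (M x)" for x by simp
  show "enn2real (M x) \<le> l"
    if s: "\<And>n. s n \<in> {0<..<B}" and x: "x \<in> {0<..<B}" and sx: "s \<longlonglongrightarrow> x" and l: "(\<lambda>n. enn2real (M (s n))) \<longlonglongrightarrow> l"
    for s x l
  proof -
    have lim: "(\<lambda>n. m (Complex \<rho> (s n))) \<longlonglongrightarrow> m (Complex \<rho> x)" for \<rho>
    proof (rule continuous_on_tendsto_compose[OF cont])
      show "(\<lambda>n. Complex \<rho> (s n)) \<longlonglongrightarrow> Complex \<rho> x"
        by (intro tendsto_intros sx)
    qed (use s x in \<open>auto simp: S_def\<close>)
    have l0: "0 \<le> l"
      by (rule LIMSEQ_le_const[OF l]) auto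
    have "M x = (\<integral>\<^sup>+\<rho>. liminf (\<lambda>n. ennreal (m (Complex \<rho> (s n)))) \<partial>lborel)"
      unfolding M_def
    proof (intro nn_integral_cong)
      fix \<rho>
      have "(\<lambda>n. ennreal (m (Complex \<rho> (s n)))) \<longlonglongrightarrow> ennreal (m (Complex \<rho> x))"
        by (intro tendsto_intros lim)
      then show "ennreal (m (Complex \<rho> x)) = liminf (\<lambda>n. ennreal (m (Complex \<rho> (s n))))"
        by (simp add: lim_imp_Liminf)
    qed
    also have "\<dots> \<le> liminf (\<lambda>n. M (s n))"
      unfolding M_def using meas s by (intro nn_integral_liminf) auto
    also have "\<dots> = ennreal l"
    proof (rule lim_imp_Liminf)
      have "M (s n) = ennreal (enn2real (M (s n)))" for n
        using fin s[of n] by simp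
      then show "(\<lambda>n. M (s n)) \<longlonglongrightarrow> ennreal l"
        using tendsto_ennrealI[OF l] by simp
    qed simp
    finally show ?thesis
      using l0 by (simp add: enn2real_leI)
  qed
  have key: "(\<lambda>t. M (x + r * sin (2 * pi * t))) \<in> borel_measurable lborel \<and>
      (\<integral>\<^sup>+t\<in>{0..1}. M (x + r * sin (2 * pi * t)) \<partial>lborel) \<le> M x"
    and inS: "\<And>t. 0 < x + r * sin (2 * pi * t) \<and> x + r * sin (2 * pi * t) < B"
    if r: "0 < r" "0 < x - r" "x + r < B" for x r
  proof -
    show inS: "0 < x + r * sin (2 * pi * t) \<and> x + r * sin (2 * pi * t) < B" for t
    proof -
      have "r * \<bar>sin (2 * pi * t)\<bar> \<le> r * 1"
        using r(1) by (intro mult_left_mono) auto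
      then have "\<bar>r * sin (2 * pi * t)\<bar> \<le> r"
        using r(1) by (simp add: abs_mult)
      then show ?thesis using r by auto
    qed
    define k where "k = (\<lambda>(t, \<rho>). ennreal (m (Complex (\<rho> + r * cos (2 * pi * t)) (x + r * sin (2 * pi * t)))))"
    have "continuous_on UNIV (\<lambda>p::real\<times>real. m (Complex (snd p + r * cos (2 * pi * fst p)) (x + r * sin (2 * pi * fst p))))"
      by (rule continuous_on_compose2[OF cont])
        (use inS in \<open>auto simp: S_def Complex_eq intro!: continuous_intros\<close>)
    then have "k \<in> borel_measurable borel"
      unfolding k_def split_beta
      using borel_measurable_continuous_onI by (intro measurable_compose[OF _ measurable_ennreal]) blast
    then have k[measurable]: "k \<in> borel_measurable (lborel \<Otimes>\<^sub>M lborel)"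
      by (simp add: lborel_prod)
    have Mk: "M (x + r * sin (2 * pi * t)) = (\<integral>\<^sup>+\<rho>. k (t, \<rho>) \<partial>lborel)" for t
      unfolding M_def k_def
      using nn_integral_real_affine[OF meas, of "x + r * sin (2 * pi * t)" 1 "r * cos (2 * pi * t)"] inS[of t]
      by (simp add: add.commute)
    have meas_M: "(\<lambda>t. M (x + r * sin (2 * pi * t))) \<in> borel_measurable lborel"
      unfolding Mk by measurable
    have "(\<integral>\<^sup>+t\<in>{0..1}. M (x + r * sin (2 * pi * t)) \<partial>lborel)
        = (\<integral>\<^sup>+t. (\<integral>\<^sup>+\<rho>. k (t, \<rho>) * indicator {0..1} t \<partial>lborel) \<partial>lborel)"
      unfolding Mk by (intro nn_integral_cong nn_integral_multc[symmetric]) measurable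
    also have "\<dots> = (\<integral>\<^sup>+\<rho>. (\<integral>\<^sup>+t. k (t, \<rho>) * indicator {0..1} t \<partial>lborel) \<partial>lborel)"
      by (rule lborel_pair.Fubini') measurable
    also have "\<dots> \<le> M x"
      unfolding M_def
    proof (intro nn_integral_mono)
      fix \<rho>
      have sub: "cball (Complex \<rho> x) r \<subseteq> S"
      proof
        fix w assume "w \<in> cball (Complex \<rho> x) r"
        then have "\<bar>Im (Complex \<rho> x - w)\<bar> \<le> r"
          using abs_Im_le_cmod order_trans by (auto simp: dist_norm simp del: minus_complex.sel)
        then show "w \<in> S" using r by (auto simp: S_def)
      qed
      have "k (t, \<rho>) = ennreal (m (Complex \<rho> x + r * cis (2 * pi * t)))" for t
        unfolding k_def prod.case by (intro arg_cong[where f="\<lambda>w. ennreal (m w)"]) (simp add: complex_eq_iff)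
      then show "(\<integral>\<^sup>+t. k (t, \<rho>) * indicator {0..1} t \<partial>lborel) \<le> ennreal (m (Complex \<rho> x))"
        using mean[OF r(1) sub] by simp
    qed
    finally show "(\<lambda>t. M (x + r * sin (2 * pi * t))) \<in> borel_measurable lborel \<and>
      (\<integral>\<^sup>+t\<in>{0..1}. M (x + r * sin (2 * pi * t)) \<partial>lborel) \<le> M x"
      using meas_M by blast
  qed
  have nn_eq: "(\<integral>\<^sup>+t. ennreal (indicator {0..1} t *\<^sub>R enn2real (M (x + r * sin (2 * pi * t)))) \<partial>lborel)
      = (\<integral>\<^sup>+t\<in>{0..1}. M (x + r * sin (2 * pi * t)) \<partial>lborel)"
    if r: "0 < r" "0 < x - r" "x + r < B" for x r
    using fin inS[OF r] by (intro nn_integral_cong) (auto simp: indicator_def)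
  show int: "set_integrable lborel {0..1} (\<lambda>t. enn2real (M (x + r * sin (2 * pi * t))))"
    if r: "0 < r" "0 < x - r" "x + r < B" for x r
    unfolding set_integrable_def
  proof (rule integrableI_nonneg)
    show "(\<lambda>t. indicator {0..1} t *\<^sub>R enn2real (M (x + r * sin (2 * pi * t)))) \<in> borel_measurable lborel"
      using key[OF r] by (intro borel_measurable_scaleR) auto
    show "(\<integral>\<^sup>+t. ennreal (indicator {0..1} t *\<^sub>R enn2real (M (x + r * sin (2 * pi * t)))) \<partial>lborel) < \<infinity>"
      unfolding nn_eq[OF r] using key[OF r] fin[of x] r by (auto intro: le_less_trans)
  qed auto
  show "(LINT t:{0..1}|lborel. enn2real (M (x + r * sin (2 * pi * t)))) \<le> enn2real (M x)"
    if r: "0 < r" "0 < x - r" "x + r < B" for x r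
  proof -
    have "ennreal (LINT t:{0..1}|lborel. enn2real (M (x + r * sin (2 * pi * t))))
        = (\<integral>\<^sup>+t. ennreal (indicator {0..1} t *\<^sub>R enn2real (M (x + r * sin (2 * pi * t)))) \<partial>lborel)"
      unfolding set_lebesgue_integral_def
      using int[OF r] by (intro nn_integral_eq_integral[symmetric]) (auto simp: set_integrable_def)
    also have "\<dots> \<le> M x"
      unfolding nn_eq[OF r] using key[OF r] by blast
    also have "\<dots> = ennreal (enn2real (M x))"
      using fin[of x] r by simp
    finally show ?thesis
      by simp
  qed
qed

section \<open>Boundary derivatives and the defect in logarithmic coordinates\<close>

lemma julia_boundary_deriv:
  assumes F: "F holomorphic_on upper_half_plane" "F ` upper_half_plane \<subseteq> ball 0 1"
    and I: "open_interval I" "y \<in> I" "extends_across F I" and one: "cmod (boundary_value F y) = 1"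
    and z: "0 < Im z"
  shows "(1 - (cmod (F z))\<^sup>2) * Im z \<le> 2 * cmod (boundary_deriv F y) * (cmod (z - y))\<^sup>2"
proof -
  obtain G where G: "is_extension_across F I G"
    using I(3) by (auto simp: extends_across_def)
  then obtain U where U: "open U" "upper_half_plane \<union> complex_of_real ` I \<subseteq> U" "G holomorphic_on U"
      "\<forall>z\<in>upper_half_plane. G z = F z"
    unfolding is_extension_across_def by blast
  have "(G has_field_derivative deriv G y) (at (complex_of_real y))"
    using U I(2) by (intro holomorphic_derivI[of G U]) auto
  then show ?thesis
    unfolding boundary_deriv_eq[OF I(1,2) G]
    by (rule julia_inequality[OF F]) (use U one z in \<open>auto simp: boundary_value_eq[OF I(1,2) G] upper_half_plane_def\<close>)
qed

lemma continuous_on_boundary_deriv: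
  assumes "\<forall>I\<in>\<I>. open_interval I" "\<forall>I\<in>\<I>. extends_across F I"
  shows "continuous_on (\<Union>\<I>) (boundary_deriv F)"
proof (rule continuous_on_open_Union)
  fix I assume I: "I \<in> \<I>"
  then show "open I" using assms by (auto simp: open_interval_def)
  obtain G where G: "is_extension_across F I G"
    using I assms by (auto simp: extends_across_def)
  then obtain U where U: "open U" "upper_half_plane \<union> complex_of_real ` I \<subseteq> U" "G holomorphic_on U"
    unfolding is_extension_across_def by blast
  have "continuous_on U (deriv G)"
    using U by (intro holomorphic_on_imp_continuous_on holomorphic_deriv)
  then have "continuous_on I (\<lambda>x. deriv G (complex_of_real x))"
    by (rule continuous_on_compose2) (use U in \<open>auto intro!: continuous_intros\<close>)
  moreover have "boundary_deriv F x = deriv G (complex_of_real x)" if "x \<in> I" for x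
    using boundary_deriv_eq[OF _ that G] I assms by blast
  ultimately show "continuous_on I (boundary_deriv F)"
    by (simp cong: continuous_on_cong)
qed

lemma Im_exp_strip: "0 < Im w \<Longrightarrow> Im w < pi \<Longrightarrow> 0 < Im (exp w)"
  by (simp add: Im_exp sin_gt_zero)

text \<open>
  For each of two maps into the disc, composition with the exponential gives a superharmonic defect
  on the strip; the minimum inherits the mean inequality from both.  The second map will be the
  reflection of the first in the imaginary axis.
\<close>
lemma concave_on_ray_integrals:
  assumes F: "F holomorphic_on upper_half_plane" "F ` upper_half_plane \<subseteq> ball 0 1"
    and K: "K holomorphic_on upper_half_plane" "K ` upper_half_plane \<subseteq> ball 0 1"
  defines "M \<equiv> \<lambda>\<theta>. \<integral>\<^sup>+\<rho>. ennreal (min (1 - (cmod (F (exp (Complex \<rho> \<theta>))))\<^sup>2)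
                                       (1 - (cmod (K (exp (Complex \<rho> \<theta>))))\<^sup>2)) \<partial>lborel"
  assumes fin: "\<And>\<theta>. \<lbrakk>0 < \<theta>; \<theta> < pi\<rbrakk> \<Longrightarrow> M \<theta> < \<infinity>"
  shows "concave_on {0<..<pi} (\<lambda>\<theta>. enn2real (M \<theta>))"
proof -
  define S where "S = {w. 0 < Im w \<and> Im w < pi}"
  define v where "v = (\<lambda>f::complex\<Rightarrow>complex. \<lambda>w. 1 - (cmod (f (exp w)))\<^sup>2)"
  have hol: "(\<lambda>w. f (exp w)) holomorphic_on S" if "f holomorphic_on upper_half_plane" for f
  proof -
    have "exp ` S \<subseteq> upper_half_plane"
      by (auto simp: S_def upper_half_plane_def intro: Im_exp_strip)
    then show ?thesis
      using holomorphic_on_compose_gen[OF holomorphic_on_exp that] by (simp add: o_def)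
  qed
  have le1: "cmod (f (exp w)) \<le> 1" if "f ` upper_half_plane \<subseteq> ball 0 1" "w \<in> S" for f w
    using that Im_exp_strip[of w] by (force simp: S_def upper_half_plane_def image_subset_iff)
  have cont: "continuous_on S (v f)" if "f holomorphic_on upper_half_plane" for f
    unfolding v_def using holomorphic_on_imp_continuous_on[OF hol[OF that]] by (intro continuous_intros)
  have mean: "(\<integral>\<^sup>+t\<in>{0..1}. ennreal (v f (c + r * cis (2 * pi * t))) \<partial>lborel) \<le> ennreal (v f c)"
    if f: "f holomorphic_on upper_half_plane" "f ` upper_half_plane \<subseteq> ball 0 1" and r: "0 < r" "cball c r \<subseteq> S" for f c r
    unfolding v_def
    by (rule circle_mean_one_minus_norm_sq[OF holomorphic_on_subset[OF hol[OF f(1)] r(2)] r(1)]) (use le1 f r in blast)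
  have "concave_on {0<..<pi} (\<lambda>\<theta>. enn2real (\<integral>\<^sup>+\<rho>. ennreal (min (v F (Complex \<rho> \<theta>)) (v K (Complex \<rho> \<theta>))) \<partial>lborel))"
  proof (rule concave_on_line_integrals)
    show "continuous_on {w. 0 < Im w \<and> Im w < pi} (\<lambda>w. min (v F w) (v K w))"
      using cont F K unfolding S_def by (intro continuous_intros) auto
    show "(\<integral>\<^sup>+\<rho>. ennreal (min (v F (Complex \<rho> \<theta>)) (v K (Complex \<rho> \<theta>))) \<partial>lborel) < \<infinity>"
      if "0 < \<theta>" "\<theta> < pi" for \<theta>
      using fin[OF that] by (simp add: M_def v_def)
    show "(\<integral>\<^sup>+t\<in>{0..1}. ennreal (min (v F (c + r * cis (2 * pi * t))) (v K (c + r * cis (2 * pi * t)))) \<partial>lborel)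
        \<le> ennreal (min (v F c) (v K c))" (is "?l \<le> _")
      if r: "0 < r" "cball c r \<subseteq> {w. 0 < Im w \<and> Im w < pi}" for c r
    proof -
      have "?l \<le> (\<integral>\<^sup>+t\<in>{0..1}. ennreal (v F (c + r * cis (2 * pi * t))) \<partial>lborel)"
        by (intro nn_integral_mono mult_right_mono ennreal_leI) auto
      also have "\<dots> \<le> ennreal (v F c)"
        using mean[OF F] r by (simp add: S_def)
      finally have 1: "?l \<le> ennreal (v F c)" .
      have "?l \<le> (\<integral>\<^sup>+t\<in>{0..1}. ennreal (v K (c + r * cis (2 * pi * t))) \<partial>lborel)"
        by (intro nn_integral_mono mult_right_mono ennreal_leI) auto
      also have "\<dots> \<le> ennreal (v K c)"
        using mean[OF K] r by (simp add: S_def)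
      finally show ?thesis
        using 1 by (simp add: min_def)
    qed
  qed
  then show ?thesis
    by (simp add: M_def v_def)
qed

text \<open>
  The chord from \<open>0\<close> would give this at once, but \<open>f\<close> is only concave on the open interval: the
  chord starts at a point \<open>d > 0\<close>, where \<open>f d \<ge> 0\<close>, and \<open>d\<close> then tends to \<open>0\<close>.
\<close>
lemma concave_on_nonneg_scale:
  fixes f :: "real \<Rightarrow> real"
  assumes f: "concave_on {0<..<B} f" and nn: "\<And>x. 0 \<le> f x" and e: "0 < e" "e < b" "b < B"
  shows "e * f b \<le> b * f e"
proof -
  have "(e - d) * f b \<le> (b - d) * f e" if d: "0 < d" "d < e" for d
  proof -
    define l where "l = (e - d) / (b - d)"
    have l: "0 \<le> l" "l \<le> 1" using d e by (auto simp: l_def)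
    have bd: "b - d \<noteq> 0" "0 < b - d" using d e by auto
    have "l * (b - d) = e - d" using bd by (simp add: l_def)
    then have "(1 - l) * d + l * b = e" by (simp add: algebra_simps)
    moreover have "(1 - l) * f d + l * f b \<le> f ((1 - l) *\<^sub>R d + l *\<^sub>R b)"
      using f l d e unfolding concave_on_iff by auto
    moreover have "0 \<le> (1 - l) * f d" using l nn by simp
    ultimately have "l * f b \<le> f e" by simp
    then have "(b - d) * (l * f b) \<le> (b - d) * f e"
      using bd by (intro mult_left_mono) auto
    then show ?thesis using bd by (simp add: l_def)
  qed
  then have ev: "\<forall>\<^sub>F d in at_right 0. (e - d) * f b \<le> (b - d) * f e"
    using eventually_at_right_real[OF e(1)] by (auto elim: eventually_mono)
  have "((\<lambda>d. (e - d) * f b) \<longlongrightarrow> (e - 0) * f b) (at_right 0)"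
    and "((\<lambda>d. (b - d) * f e) \<longlongrightarrow> (b - 0) * f e) (at_right 0)"
    by (intro tendsto_intros)+
  then show ?thesis
    using tendsto_le[OF _ _ _ ev] by fastforce
qed

lemma nn_integral_along_ray:
  fixes k :: "complex \<Rightarrow> real"
  assumes k: "continuous_on upper_half_plane k" and \<theta>: "0 < \<theta>" "\<theta> < pi"
  shows "(\<integral>\<^sup>+\<rho>. ennreal (k (exp (Complex \<rho> \<theta>))) \<partial>lborel)
       = (\<integral>\<^sup>+x\<in>{0<..}. ennreal (k (of_real x * cis \<theta>) / x) \<partial>lborel)"
proof -
  have "continuous_on {0<..} (\<lambda>x. k (of_real x * cis \<theta>))"
    by (rule continuous_on_compose2[OF k])
      (use \<theta> in \<open>auto simp: upper_half_plane_def sin_gt_zero intro!: continuous_intros\<close>)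
  then have "(\<lambda>x. indicator {0<..} x *\<^sub>R (k (of_real x * cis \<theta>) / x)) \<in> borel_measurable borel"
    by (intro borel_measurable_continuous_on_indicator continuous_intros) auto
  then have meas: "(\<lambda>x. ennreal (indicator {0<..} x *\<^sub>R (k (of_real x * cis \<theta>) / x))) \<in> borel_measurable borel"
    by simp
  have e: "exp (Complex \<rho> \<theta>) = of_real (exp \<rho>) * cis \<theta>" for \<rho>
    by (simp add: exp_eq_polar)
  have "(\<integral>\<^sup>+x\<in>{0<..}. ennreal (k (of_real x * cis \<theta>) / x) \<partial>lborel)
      = (\<integral>\<^sup>+x\<in>{0<..}. ennreal (indicator {0<..} x *\<^sub>R (k (of_real x * cis \<theta>) / x)) \<partial>lborel)"
    by (intro nn_integral_cong) (auto simp: indicator_def)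
  also have "\<dots> = (\<integral>\<^sup>+\<rho>. ennreal (k (of_real (exp \<rho>) * cis \<theta>) / exp \<rho>) * ennreal (exp \<rho>) \<partial>lborel)"
    using nn_integral_exp_substitution[OF meas] by simp
  also have "\<dots> = (\<integral>\<^sup>+\<rho>. ennreal (k (exp (Complex \<rho> \<theta>))) \<partial>lborel)"
    unfolding e by (intro nn_integral_cong) (simp flip: ennreal_mult'')
  finally show ?thesis ..
qed

lemma norm_cis_diff: "(cmod (of_real x * cis \<theta> - of_real x))\<^sup>2 = 2 * x\<^sup>2 * (1 - cos \<theta>)"
proof -
  have "(cmod (of_real x * cis \<theta> - of_real x))\<^sup>2 = (x * cos \<theta> - x)\<^sup>2 + (x * sin \<theta>)\<^sup>2"
    unfolding cmod_power2 by simp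
  also have "\<dots> = x\<^sup>2 * ((sin \<theta>)\<^sup>2 + (cos \<theta>)\<^sup>2) + x\<^sup>2 * (1 - 2 * cos \<theta>)"
    by algebra
  finally show ?thesis
    unfolding sin_cos_squared_add by (simp add: algebra_simps)
qed

lemma one_minus_cos_tan_half:
  fixes \<theta> :: real
  assumes "0 < \<theta>" "\<theta> < pi"
  shows "1 - cos \<theta> = tan (\<theta> / 2) * sin \<theta>"
proof -
  have c: "cos (\<theta> / 2) \<noteq> 0"
    using assms cos_gt_zero[of "\<theta> / 2"] by simp
  have "1 - cos \<theta> = 2 * (sin (\<theta> / 2))\<^sup>2"
    using cos_double_sin[of "\<theta> / 2"] by simp
  also have "\<dots> = tan (\<theta> / 2) * sin \<theta>"
    using c sin_double[of "\<theta> / 2"] by (simp add: tan_def power2_eq_square)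
  finally show ?thesis .
qed

lemma tan_half_over_tendsto: "((\<lambda>\<theta>::real. tan (\<theta> / 2) / \<theta>) \<longlongrightarrow> 1 / 2) (at_right 0)"
proof -
  have "((\<lambda>\<theta>::real. tan (\<theta> / 2)) has_real_derivative 1 / 2) (at 0)"
    by (auto intro!: derivative_eq_intros)
  then have "((\<lambda>\<theta>::real. tan (\<theta> / 2) / \<theta>) \<longlongrightarrow> 1 / 2) (at 0)"
    by (simp add: has_field_derivative_iff)
  then show ?thesis
    by (rule filterlim_mono) (auto intro: at_le)
qed

section \<open>The integral inequality\<close>

theorem lemma2p1:
  fixes F :: "complex \<Rightarrow> complex" and E :: "real set" and \<I> :: "real set set"
  assumes "F holomorphic_on upper_half_plane"
    and "inj_on F upper_half_plane"
    and "F ` upper_half_plane \<subseteq> ball 0 1"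
    and "finite \<I>"
    and "\<forall>I\<in>\<I>. open_interval I"
    and "pairwise disjnt \<I>"
    and "E = \<Union>\<I>"
    and "AE x in lborel. x > 0 \<longrightarrow> (x \<in> E \<longleftrightarrow> - x \<notin> E)"
    and "\<forall>I\<in>\<I>. extends_across F I"
    and "\<forall>x\<in>E. norm (boundary_value F x) = 1"
  shows "(\<integral>\<^sup>+y\<in>{0<..}. ennreal (norm (deriv F (\<i> * complex_of_real y))) \<partial>lborel)
           \<le> ennreal (pi / 2) * (\<integral>\<^sup>+x\<in>E. ennreal (norm (boundary_deriv F x)) \<partial>lborel)"
proof -
  define A where "A = (\<integral>\<^sup>+x\<in>E. ennreal (norm (boundary_deriv F x)) \<partial>lborel)"
  \<comment> \<open>The reflection of \<open>F\<close> in the imaginary axis; its modulus at \<open>z\<close> is that of \<open>F\<close> at \<open>- cnj z\<close>.\<close>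
  define F\<^sub>r where "F\<^sub>r = cnj \<circ> (\<lambda>z. F (- z)) \<circ> cnj"
  define k where "k = (\<lambda>z. min (1 - (cmod (F z))\<^sup>2) (1 - (cmod (F\<^sub>r z))\<^sup>2))"
  define M where "M = (\<lambda>\<theta>. \<integral>\<^sup>+\<rho>. ennreal (k (exp (Complex \<rho> \<theta>))) \<partial>lborel)"
  note F = assms(1,3)
  have op: "open upper_half_plane"
    unfolding upper_half_plane_def by (rule open_halfspace_Im_gt)
  have norm_Fr: "cmod (F\<^sub>r z) = cmod (F (- cnj z))" for z
    by (simp add: F\<^sub>r_def)
  have "(F \<circ> uminus) holomorphic_on cnj ` upper_half_plane"
    by (rule holomorphic_on_compose_gen[OF _ F(1)]) (auto simp: upper_half_plane_def intro!: holomorphic_intros)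
  then have hol_Fr: "F\<^sub>r holomorphic_on upper_half_plane"
    unfolding F\<^sub>r_def using op by (intro holomorphic_on_compose_cnj_cnj) (auto simp: o_def)
  have bound_Fr: "F\<^sub>r ` upper_half_plane \<subseteq> ball 0 1"
    using F(2) by (auto simp: norm_Fr upper_half_plane_def image_subset_iff)
  have kcont: "continuous_on upper_half_plane k"
    unfolding k_def using F(1) hol_Fr
    by (intro continuous_intros holomorphic_on_imp_continuous_on)

  define h where "h = (\<lambda>x. ennreal (norm (boundary_deriv F x)) * indicator E x)"
  have "open E"
    using assms(5,7) by (auto simp: open_interval_def)
  then have Eb: "E \<in> sets borel" by simp
  have "continuous_on E (\<lambda>x. norm (boundary_deriv F x))"
    unfolding assms(7) using continuous_on_boundary_deriv[OF assms(5,9)] by (intro continuous_intros)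
  then have "(\<lambda>x. indicator E x *\<^sub>R norm (boundary_deriv F x)) \<in> borel_measurable borel"
    using Eb by (intro borel_measurable_continuous_on_indicator)
  then have "(\<lambda>x. ennreal (indicator E x *\<^sub>R norm (boundary_deriv F x))) \<in> borel_measurable borel"
    by simp
  moreover have "h = (\<lambda>x. ennreal (indicator E x *\<^sub>R norm (boundary_deriv F x)))"
    by (auto simp: h_def indicator_def)
  ultimately have h[measurable]: "h \<in> borel_measurable borel" by simp
  have A_fold: "A = (\<integral>\<^sup>+x\<in>{0<..}. (h x + h (- x)) \<partial>lborel)"
    unfolding A_def using nn_integral_fold[OF h] by (simp add: h_def)

  have julia_E: "(1 - (cmod (F z))\<^sup>2) * Im z \<le> 2 * cmod (boundary_deriv F y) * (cmod (z - y))\<^sup>2"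
    if yE: "y \<in> E" and z: "0 < Im z" for y z
  proof -
    obtain I where "I \<in> \<I>" "y \<in> I"
      using yE assms(7) by blast
    then show ?thesis
      using yE z assms(5,9,10) by (intro julia_boundary_deriv[OF F, of I]) auto
  qed
  \<comment> \<open>If \<open>y = x\<close>, Julia's inequality applies at \<open>x cis \<theta>\<close>, the first branch of \<open>k\<close>; if \<open>y = - x\<close>, it
    applies at the mirror image of that point, the second branch, at the same distance from \<open>y\<close>.\<close>
  have k_le: "k (of_real x * cis \<theta>) / x \<le> 4 * tan (\<theta> / 2) * cmod (boundary_deriv F y)"
    if \<theta>: "0 < \<theta>" "\<theta> < pi" and x: "0 < x" and y: "y \<in> E" "y = x \<or> y = - x" for \<theta> x y
  proof -
    define z where "z = of_real x * cis \<theta>"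
    have s: "0 < sin \<theta>" using \<theta> by (rule sin_gt_zero)
    have Imz: "Im z = x * sin \<theta>" by (simp add: z_def)
    define z' where "z' = (if y = x then z else - cnj z)"
    have "k z \<le> 1 - (cmod (F z'))\<^sup>2"
      by (simp add: k_def z'_def norm_Fr)
    moreover have "Im z' = x * sin \<theta>" by (simp add: z'_def Imz)
    moreover have "cmod (z' - y) = cmod (z - x)"
    proof (cases "y = x")
      case False
      then have "z' - y = - cnj (z - x)" using y by (simp add: z'_def)
      then show ?thesis by (metis complex_mod_cnj norm_minus_cancel)
    qed (simp add: z'_def)
    ultimately have "k z * (x * sin \<theta>) \<le> 2 * cmod (boundary_deriv F y) * (cmod (z - x))\<^sup>2"
      using julia_E[OF y(1), of z'] x s by (smt (verit) mult_right_mono mult_pos_pos)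
    also have "(cmod (z - x))\<^sup>2 = 2 * x\<^sup>2 * (tan (\<theta> / 2) * sin \<theta>)"
      unfolding z_def norm_cis_diff one_minus_cos_tan_half[OF \<theta>] ..
    finally have "k z * (x * sin \<theta>) \<le> (4 * tan (\<theta> / 2) * cmod (boundary_deriv F y) * x) * (x * sin \<theta>)"
      by (simp add: power2_eq_square mult_ac)
    then have "k z \<le> 4 * tan (\<theta> / 2) * cmod (boundary_deriv F y) * x"
      using x s by simp
    then show ?thesis
      using x by (simp add: z_def divide_le_eq)
  qed
  \<comment> \<open>The sum \<open>h x + h (- x)\<close> serves both cases: it dominates the term of whichever of \<open>x\<close>, \<open>- x\<close> lies in
    \<open>E\<close>, and its integral over the positive axis is \<open>A\<close>.\<close>
  have M_le: "M \<theta> \<le> ennreal (4 * tan (\<theta> / 2)) * A" if \<theta>: "0 < \<theta>" "\<theta> < pi" for \<theta>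
  proof -
    have t0: "0 \<le> tan (\<theta> / 2)" using \<theta> tan_gt_zero[of "\<theta> / 2"] by simp
    have "M \<theta> = (\<integral>\<^sup>+x\<in>{0<..}. ennreal (k (of_real x * cis \<theta>) / x) \<partial>lborel)"
      unfolding M_def by (rule nn_integral_along_ray[OF kcont \<theta>])
    also have "\<dots> \<le> (\<integral>\<^sup>+x. ennreal (4 * tan (\<theta> / 2)) * ((h x + h (- x)) * indicator {0<..} x) \<partial>lborel)"
    proof (rule nn_integral_mono_AE)
      show "AE x in lborel. ennreal (k (of_real x * cis \<theta>) / x) * indicator {0<..} x
          \<le> ennreal (4 * tan (\<theta> / 2)) * ((h x + h (- x)) * indicator {0<..} x)"
        using assms(8)
      proof eventually_elim
        case (elim x)
        show ?case
        proof (cases "0 < x")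
          case True
          then obtain y where y: "y \<in> E" "y = x \<or> y = - x" using elim by blast
          have "ennreal (k (of_real x * cis \<theta>) / x) \<le> ennreal (4 * tan (\<theta> / 2) * cmod (boundary_deriv F y))"
            using k_le[OF \<theta> True y] by (rule ennreal_leI)
          also have "\<dots> = ennreal (4 * tan (\<theta> / 2)) * h y"
            using y(1) t0 by (simp add: h_def ennreal_mult)
          also have "\<dots> \<le> ennreal (4 * tan (\<theta> / 2)) * (h x + h (- x))"
            using y(2) by (intro mult_left_mono) (auto intro: add_increasing add_increasing2)
          finally show ?thesis using True by simp
        qed simp
      qed
    qed
    also have "\<dots> = ennreal (4 * tan (\<theta> / 2)) * A"
      unfolding A_fold by (rule nn_integral_cmult) measurable
    finally show ?thesis .
  qed

  have lhs: "(\<integral>\<^sup>+y\<in>{0<..}. ennreal (norm (deriv F (\<i> * complex_of_real y))) \<partial>lborel) \<le> ennreal (1 / 2) * M (pi / 2)"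
  proof -
    define g where "g = (\<lambda>y. ennreal (k (of_real y * cis (pi / 2)) / y) * indicator {0<..} y)"
    have "(\<integral>\<^sup>+y\<in>{0<..}. ennreal (norm (deriv F (\<i> * complex_of_real y))) \<partial>lborel)
       \<le> (\<integral>\<^sup>+y. ennreal (1 / 2) * g y \<partial>lborel)"
    proof (rule nn_integral_mono)
      fix y :: real
      show "ennreal (norm (deriv F (\<i> * complex_of_real y))) * indicator {0<..} y \<le> ennreal (1 / 2) * g y"
      proof (cases "0 < y")
        case True
        have "- cnj (\<i> * complex_of_real y) = \<i> * complex_of_real y" by simp
        then have "k (of_real y * cis (pi / 2)) = 1 - (cmod (F (\<i> * of_real y)))\<^sup>2"
          by (simp add: k_def norm_Fr mult.commute)
        then have "norm (deriv F (\<i> * complex_of_real y)) \<le> 1 / 2 * (k (of_real y * cis (pi / 2)) / y)"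
          using schwarz_pick_deriv[OF F, of "\<i> * of_real y"] True by (simp add: field_simps)
        then have "ennreal (norm (deriv F (\<i> * complex_of_real y))) \<le> ennreal (1 / 2) * ennreal (k (of_real y * cis (pi / 2)) / y)"
          by (subst ennreal_mult'[symmetric]) (auto intro: ennreal_leI)
        then show ?thesis using True by (simp add: g_def)
      qed simp
    qed
    also have "\<dots> \<le> ennreal (1 / 2) * (\<integral>\<^sup>+y. g y \<partial>lborel)"
    proof -
      have "continuous_on {0<..} (\<lambda>y. k (of_real y * cis (pi / 2)))"
        by (rule continuous_on_compose2[OF kcont]) (auto simp: upper_half_plane_def intro!: continuous_intros)
      then have "(\<lambda>y. indicator {0<..} y *\<^sub>R (k (of_real y * cis (pi / 2)) / y)) \<in> borel_measurable borel"
        by (intro borel_measurable_continuous_on_indicator continuous_intros) auto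
      then have "(\<lambda>y. ennreal (indicator {0<..} y *\<^sub>R (k (of_real y * cis (pi / 2)) / y))) \<in> borel_measurable borel"
        by simp
      moreover have "g = (\<lambda>y. ennreal (indicator {0<..} y *\<^sub>R (k (of_real y * cis (pi / 2)) / y)))"
        by (auto simp: g_def indicator_def)
      ultimately have "g \<in> borel_measurable lborel" by simp
      then show ?thesis by (simp add: nn_integral_cmult)
    qed
    also have "(\<integral>\<^sup>+y. g y \<partial>lborel) = M (pi / 2)"
      unfolding M_def g_def by (rule nn_integral_along_ray[symmetric, OF kcont]) auto
    finally show ?thesis .
  qed

  show ?thesis
  proof (cases "A = \<infinity>")
    case True
    then show ?thesis
      by (simp add: A_def[symmetric] ennreal_mult_top)
  next
    case False
    then obtain a where a: "A = ennreal a" "0 \<le> a"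
      by (cases A) auto
    define \<mu> where "\<mu> = (\<lambda>\<theta>. enn2real (M \<theta>))"
    have M_le': "M \<theta> \<le> ennreal (4 * tan (\<theta> / 2) * a)" if "0 < \<theta>" "\<theta> < pi" for \<theta>
      using M_le[OF that] a tan_gt_zero[of "\<theta> / 2"] that by (simp add: ennreal_mult)
    then have fin: "M \<theta> < \<infinity>" if "0 < \<theta>" "\<theta> < pi" for \<theta>
      using that by (metis ennreal_less_top infinity_ennreal_def le_less_trans)
    have \<mu>_le: "\<mu> \<theta> \<le> 4 * tan (\<theta> / 2) * a" if "0 < \<theta>" "\<theta> < pi" for \<theta>
      unfolding \<mu>_def using M_le'[OF that] a tan_gt_zero[of "\<theta> / 2"] that by (intro enn2real_leI) auto
    have conc: "concave_on {0<..<pi} \<mu>"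
      using concave_on_ray_integrals[OF F hol_Fr bound_Fr] fin unfolding \<mu>_def M_def k_def by simp
    have ev: "\<forall>\<^sub>F \<epsilon> in at_right 0. \<mu> (pi / 2) \<le> (pi / 2) * (4 * (tan (\<epsilon> / 2) / \<epsilon>) * a)"
      using eventually_at_right_real[of 0 "pi / 2", OF pi_half_gt_zero]
    proof eventually_elim
      case (elim \<epsilon>)
      have "\<epsilon> * \<mu> (pi / 2) \<le> (pi / 2) * \<mu> \<epsilon>"
        using elim by (intro concave_on_nonneg_scale[OF conc]) (auto simp: \<mu>_def)
      also have "\<dots> \<le> (pi / 2) * (4 * tan (\<epsilon> / 2) * a)"
        using elim by (intro mult_left_mono \<mu>_le) auto
      finally show ?case
        using elim by (simp add: field_simps)
    qed
    have "((\<lambda>\<epsilon>. (pi / 2) * (4 * (tan (\<epsilon> / 2) / \<epsilon>) * a)) \<longlongrightarrow> (pi / 2) * (4 * (1 / 2) * a)) (at_right 0)"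
      by (intro tendsto_intros tan_half_over_tendsto)
    then have "\<mu> (pi / 2) \<le> (pi / 2) * (4 * (1 / 2) * a)"
      using ev by (intro tendsto_lowerbound) auto
    then have "ennreal (\<mu> (pi / 2)) \<le> ennreal (pi * a)"
      by (intro ennreal_leI) simp
    moreover have "M (pi / 2) = ennreal (\<mu> (pi / 2))"
      using fin[of "pi / 2"] by (simp add: \<mu>_def)
    ultimately have "M (pi / 2) \<le> ennreal (pi * a)"
      by simp
    then have "ennreal (1 / 2) * M (pi / 2) \<le> ennreal (1 / 2) * ennreal (pi * a)"
      by (rule mult_left_mono) simp
    also have "\<dots> = ennreal (1 / 2 * (pi * a))"
      by (rule ennreal_mult'[symmetric]) simp
    also have "\<dots> = ennreal (pi / 2 * a)"
      by simp
    also have "\<dots> = ennreal (pi / 2) * A"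
      unfolding a(1) by (rule ennreal_mult') simp
    finally show ?thesis
      using lhs unfolding A_def by (rule order_trans[rotated])
  qed
qed

end
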